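(* Let $G$ be a directed simple graph on $n$ nodes and let $H$ be a spanning subgraph of $G$ where the in- and outdegree equals one for all nodes in $H$. Let $X \in \{0,1\}^{n\times n}$ be the adjacency matrix of $H$, let $k_n := \cos(2\pi/n)$ and $h_n := 1 - k_n$, and let $\alpha,\beta \in \mathbb{R}$ be such that $\alpha \ge h_n/n$ and $k_n \le \beta < 1$. Then $H$ is a directed Hamiltonian cycle if and only if $$\beta I_n + \alpha J_n - \tfrac12 (X + X^\top) \succeq 0.$$
   Context: $I_n$ is the identity matrix and $J_n$ the all-ones matrix of order $n$; $\succeq 0$ denotes positive semidefiniteness. The adjacency matrix of a directed graph has entry $(i,j)$ equal to $1$ if there is an arc from $i$ to $j$ and $0$ otherwise. A directed Hamiltonian cycle is a directed cycle visiting all nodes exactly once. *)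

theory Defs
  imports Complex_Main "Graph_Theory.Digraph_Component" "Jordan_Normal_Form.Matrix"
begin

text \<open>The function \<open>v\<close> numbers the vertices, fixing the order of the rows and columns.\<close>

definition adjacency_matrix :: "('a, 'b) pre_digraph \<Rightarrow> (nat \<Rightarrow> 'a) \<Rightarrow> nat \<Rightarrow> real mat" where
  "adjacency_matrix H v n = mat n n (\<lambda>(i, j). if v i \<rightarrow>\<^bsub>H\<^esub> v j then 1 else 0)"

definition all_ones_mat :: "nat \<Rightarrow> real mat" where
  "all_ones_mat n = mat n n (\<lambda>_. 1)"

definition pos_semidef :: "real mat \<Rightarrow> bool" where
  "pos_semidef A \<longleftrightarrow> square_mat A \<and> transpose_mat A = A \<and>
     (\<forall>x \<in> carrier_vec (dim_row A). 0 \<le> x \<bullet> (A *\<^sub>v x))"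

text \<open>
  The predicate \<^const>\<open>pre_digraph.cycle\<close> requires a nonempty closed walk without repeated
  vertices (apart from its two ends), so no vertex is visited twice. The vertices visited by
  a closed walk are the tails of its arcs.
\<close>

definition hamiltonian_cycle :: "('a, 'b) pre_digraph \<Rightarrow> 'b list \<Rightarrow> bool" where
  "hamiltonian_cycle G p \<longleftrightarrow> pre_digraph.cycle G p \<and> tail G ` set p = verts G"

text \<open>A subgraph \<open>H\<close> of \<open>G\<close> is identified with a cycle when it consists of exactly the
  vertices and arcs of that cycle.\<close>

definition is_hamiltonian_cycle_of :: "('a, 'b) pre_digraph \<Rightarrow> ('a, 'b) pre_digraph \<Rightarrow> bool" where
  "is_hamiltonian_cycle_of H G \<longleftrightarrow>
     spanning H G \<and> (\<exists>p. hamiltonian_cycle G p \<and> set p = arcs H)"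

end

theory Submission
  imports Defs "HOL-Combinatorics.Cycles"
begin

text \<open>
  Since every in- and outdegree of \<open>H\<close> is one, the quadratic form of the matrix at a function \<open>f\<close>
  on the vertices is \<open>\<beta> \<Sum>\<^sub>u f(u)\<^sup>2 + \<alpha> (\<Sum>\<^sub>u f(u))\<^sup>2 - \<Sum>\<^sub>e f(tail e) f(head e)\<close>. If \<open>H\<close> has a proper nonempty
  union of components, a function with sum zero that is constant on this set and on its complement
  makes the form equal to \<open>(\<beta> - 1) \<Sum>\<^sub>u f(u)\<^sup>2 < 0\<close>. If \<open>H\<close> is a single cycle, the last sum is a
  cyclic autocorrelation, and after subtracting the mean of \<open>f\<close> the form is nonnegative by the
  discrete Wirtinger inequality \<open>\<Sum>\<^sub>i y\<^sub>i y\<^sub>i\<^sub>+\<^sub>1 \<le> cos (2\<pi>/n) \<Sum>\<^sub>i y\<^sub>i\<^sup>2\<close> for \<open>\<Sum>\<^sub>i y\<^sub>i = 0\<close>.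
\<close>

section \<open>Trigonometric sums and the discrete Wirtinger inequality\<close>

text \<open>This is the real part of a geometric sum in the root of unity \<open>z\<close>: either
  \<open>z = 1\<close> and every term is 1, or \<open>z ^ n = 1\<close> with
  \<open>z \<noteq> 1\<close> and the sum vanishes. It serves as the orthogonality relation of the
  Fourier modes.\<close>

lemma sum_cos_multiples:
  fixes d :: int
  assumes "n > 0"
  shows "(\<Sum>k<n. cos (2 * pi * real k * of_int d / real n)) = (if int n dvd d then real n else 0)"
proof -
  define z where "z = cis (2 * pi * of_int d / real n)"
  have pow: "z ^ k = cis (2 * pi * real k * of_int d / real n)" for k
    by (simp add: z_def DeMoivre mult_ac)
  have z1: "z = 1 \<longleftrightarrow> int n dvd d"
  proof
    assume "z = 1"
    then have "cos (2 * pi * of_int d / real n) = 1"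
      by (metis z_def cis.sel(1) one_complex.sel(1))
    then obtain m :: int where "2 * pi * of_int d / real n = of_int m * 2 * pi"
      using cos_one_2pi_int by blast
    then have "real_of_int d = of_int (m * int n)"
      using assms by (simp add: field_simps)
    then have "d = m * int n"
      by linarith
    then show "int n dvd d"
      by simp
  next
    assume "int n dvd d"
    then obtain m where "d = int n * m" ..
    then have "2 * pi * of_int d / real n = 2 * pi * of_int m"
      using assms by simp
    then show "z = 1"
      by (simp only: z_def cis_multiple_2pi Ints_of_int)
  qed
  have "(\<Sum>k<n. z ^ k) = (if int n dvd d then of_nat n else 0)"
  proof (cases "z = 1")
    case False
    have "z ^ n = cis (2 * pi * of_int d)"
      unfolding pow using assms by (intro arg_cong[where f = cis]) simp
    then have "z ^ n = 1"
      by (simp only: cis_multiple_2pi Ints_of_int)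
    with False z1 show ?thesis
      by (simp add: sum_gp_strict)
  qed (use z1 in simp)
  then have "Re (\<Sum>k<n. z ^ k) = (if int n dvd d then real n else 0)"
    by simp
  then show ?thesis
    by (simp add: pow)
qed

text \<open>Cosine decreases on the interval from 0 to pi, which settles
  \<open>2 * k \<le> n\<close>; the reflection of \<open>k\<close> to \<open>n - k\<close> preserves
  the cosine and covers the other case.\<close>

lemma cos_multiple_le:
  assumes "0 < k" "k < n"
  shows "cos (2 * pi * real k / real n) \<le> cos (2 * pi / real n)"
proof -
  have le: "cos (2 * pi * real j / real n) \<le> cos (2 * pi / real n)" if "0 < j" "2 * j \<le> n" for j
  proof -
    have "2 * real j \<le> real n"
      using that by linarith
    then have "2 * pi * real j \<le> pi * real n"
      using pi_ge_zero by (metis mult.commute mult.left_commute mult_left_mono)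
    then show ?thesis
      using that by (intro cos_monotone_0_pi_le divide_right_mono) (auto simp: field_simps)
  qed
  show ?thesis
  proof (cases "2 * k \<le> n")
    case True
    then show ?thesis
      using assms le by simp
  next
    case False
    have "2 * pi * real k / real n = 2 * pi - 2 * pi * real (n - k) / real n"
      using assms by (simp add: of_nat_diff field_simps)
    then have "cos (2 * pi * real k / real n) = cos (2 * pi * real (n - k) / real n)"
      by (simp add: cos_2pi_minus)
    also have "\<dots> \<le> cos (2 * pi / real n)"
      using False assms by (intro le) auto
    finally show ?thesis .
  qed
qed

text \<open>Both sides are the squared modulus of the sum of \<open>y i * cis (t * real i)\<close>,
  the right one multiplied out.\<close>

lemma cos_sum_squares:
  fixes y :: "nat \<Rightarrow> real"
  shows "(\<Sum>i<n. y i * cos (t * real i))\<^sup>2 + (\<Sum>i<n. y i * sin (t * real i))\<^sup>2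
    = (\<Sum>i<n. \<Sum>j<n. y i * y j * cos (t * (real j - real i)))"
  by (simp add: power2_eq_square sum_product cos_diff right_diff_distrib distrib_left
      sum.distrib algebra_simps)

lemma cyclic_shift_unique:
  assumes "i < n" "j < n"
  shows "int n dvd int j - int i - 1 \<longleftrightarrow> j = Suc i mod n"
proof -
  have "int n dvd int j - int i - 1 \<longleftrightarrow> int j mod int n = int (Suc i) mod int n"
    by (simp add: mod_eq_dvd_iff algebra_simps)
  also have "\<dots> \<longleftrightarrow> j mod n = Suc i mod n"
    by (simp only: of_nat_mod[symmetric] of_nat_eq_iff)
  finally show ?thesis
    using assms by simp
qed

text \<open>The Fourier modes of frequency \<open>k\<close> contribute to the cyclic autocorrelation with the factor
  \<open>cos (2 \<pi> k / n)\<close>, which is at most \<open>cos (2 \<pi> / n)\<close> except for the vanishing mode \<open>k = 0\<close>.\<close>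

lemma discrete_wirtinger:
  fixes y :: "nat \<Rightarrow> real"
  assumes n: "n > 0" and y: "(\<Sum>i<n. y i) = 0"
  shows "(\<Sum>i<n. y i * y (Suc i mod n)) \<le> cos (2 * pi / real n) * (\<Sum>i<n. (y i)\<^sup>2)"
proof -
  define t where "t k = 2 * pi * real k / real n" for k :: nat
  \<comment> \<open>The power spectrum of \<open>y\<close>: \<open>P k\<close> is the squared
    modulus of its \<open>k\<close>-th discrete Fourier coefficient.\<close>
  define P where "P k = (\<Sum>i<n. y i * cos (t k * real i))\<^sup>2 + (\<Sum>i<n. y i * sin (t k * real i))\<^sup>2" for k
  define c where "c d = (if int n dvd d then real n else 0)" for d :: int
  have c: "(\<Sum>k<n. cos (t k * of_int d)) = c d" for d
    using sum_cos_multiples[OF n, of d] by (simp add: t_def c_def)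
  have P: "P k = (\<Sum>i<n. \<Sum>j<n. y i * y j * cos (t k * of_int (int j - int i)))" for k
    by (simp add: P_def cos_sum_squares)
  \<comment> \<open>Parseval's identity: summing over the frequencies first leaves only the diagonal
    \<open>i = j\<close>.\<close>
  have "(\<Sum>k<n. P k) = (\<Sum>i<n. \<Sum>j<n. \<Sum>k<n. y i * y j * cos (t k * of_int (int j - int i)))"
    unfolding P by (subst sum.swap, rule sum.cong[OF refl], rule sum.swap)
  also have "\<dots> = (\<Sum>i<n. \<Sum>j<n. y i * y j * c (int j - int i))"
    by (simp only: sum_distrib_left[symmetric] c)
  also have "\<dots> = (\<Sum>i<n. \<Sum>j<n. if j = i then real n * (y i)\<^sup>2 else 0)"
  proof (intro sum.cong refl)
    fix i j assume "i \<in> {..<n}" "j \<in> {..<n}"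
    then have "int n dvd int j - int i \<longleftrightarrow> j = i"
      by (auto simp: mod_eq_dvd_iff[symmetric] of_nat_mod[symmetric] simp del: of_nat_mod)
    then show "y i * y j * c (int j - int i) = (if j = i then real n * (y i)\<^sup>2 else 0)"
      by (simp add: c_def power2_eq_square)
  qed
  finally have sumP: "(\<Sum>k<n. P k) = real n * (\<Sum>i<n. (y i)\<^sup>2)"
    by (simp add: sum_distrib_left)
  have shift: "(\<Sum>i<n. \<Sum>j<n. y i * y j * c (int j - int i - 1))
    = real n * (\<Sum>i<n. y i * y (Suc i mod n))"
  proof -
    have "(\<Sum>i<n. \<Sum>j<n. y i * y j * c (int j - int i - 1))
      = (\<Sum>i<n. \<Sum>j<n. if j = Suc i mod n then real n * (y i * y j) else 0)"
      by (intro sum.cong refl) (auto simp: c_def cyclic_shift_unique)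
    then show ?thesis
      using n by (simp add: sum_distrib_left)
  qed
  have c_sym: "c (int j - int i + 1) = c (int i - int j - 1)" for i j
    using dvd_minus_iff[of "int n" "int i - int j - 1"] by (simp add: c_def algebra_simps)
  \<comment> \<open>Multiplying by \<open>cos (t k)\<close> splits each mode into two with the index
    difference moved by one either way, so that the sum over \<open>k\<close> now selects cyclic
    neighbours instead of the diagonal.\<close>
  have cos_prod: "cos (a * of_int d) * cos a = (cos (a * of_int (d - 1)) + cos (a * of_int (d + 1))) / 2"
    for a :: real and d
    by (simp add: cos_times_cos right_diff_distrib distrib_left)
  have "(\<Sum>k<n. P k * cos (t k)) = (\<Sum>k<n. \<Sum>i<n. \<Sum>j<n. y i * y j *
      (cos (t k * of_int (int j - int i - 1)) + cos (t k * of_int (int j - int i + 1))) / 2)"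
    unfolding P sum_distrib_right
    by (simp only: mult.assoc cos_prod times_divide_eq_right)
  also have "\<dots> = (\<Sum>i<n. \<Sum>j<n. \<Sum>k<n. y i * y j *
      (cos (t k * of_int (int j - int i - 1)) + cos (t k * of_int (int j - int i + 1))) / 2)"
    by (subst sum.swap, rule sum.cong[OF refl], rule sum.swap)
  also have "\<dots> = (\<Sum>i<n. \<Sum>j<n. y i * y j *
      (c (int j - int i - 1) + c (int j - int i + 1)) / 2)"
    by (simp only: sum_divide_distrib[symmetric] sum_distrib_left[symmetric] sum.distrib c)
  also have "\<dots> = ((\<Sum>i<n. \<Sum>j<n. y i * y j * c (int j - int i - 1)) +
      (\<Sum>i<n. \<Sum>j<n. y i * y j * c (int i - int j - 1))) / 2"
    by (simp add: c_sym distrib_left add_divide_distrib sum.distrib sum_divide_distrib)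
  \<comment> \<open>Exchanging the roles of \<open>i\<close> and \<open>j\<close> shows that
    predecessors and successors contribute equally, which cancels the factor 1/2.\<close>
  also have "(\<Sum>i<n. \<Sum>j<n. y i * y j * c (int i - int j - 1))
      = (\<Sum>i<n. \<Sum>j<n. y i * y j * c (int j - int i - 1))"
    by (subst sum.swap) (simp add: mult_ac)
  finally have sumPcos: "(\<Sum>k<n. P k * cos (t k)) = real n * (\<Sum>i<n. y i * y (Suc i mod n))"
    by (simp add: shift)
  have "P k * cos (t k) \<le> P k * cos (2 * pi / real n)" if "k < n" for k
  proof (cases "k = 0")
    case True
    then show ?thesis
      using y by (simp add: P_def t_def)
  next
    case False
    then show ?thesis
      using that cos_multiple_le[of k n] by (intro mult_left_mono) (auto simp: P_def t_def)
  qed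
  then have "(\<Sum>k<n. P k * cos (t k)) \<le> (\<Sum>k<n. P k * cos (2 * pi / real n))"
    by (intro sum_mono) simp
  then have "real n * (\<Sum>i<n. y i * y (Suc i mod n))
      \<le> real n * (cos (2 * pi / real n) * (\<Sum>i<n. (y i)\<^sup>2))"
    by (simp add: sumPcos sum_distrib_right[symmetric] sumP mult_ac)
  then show ?thesis
    using n by simp
qed

lemma sum_cyclic_shift:
  fixes f :: "nat \<Rightarrow> 'c::comm_monoid_add"
  assumes "n > 0"
  shows "(\<Sum>i<n. f (Suc i mod n)) = (\<Sum>i<n. f i)"
proof -
  obtain m where m: "n = Suc m"
    using assms gr0_implies_Suc by blast
  show ?thesis
    unfolding m by (subst sum.lessThan_Suc, subst sum.lessThan_Suc_shift) (simp add: add.commute)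
qed

text \<open>Subtracting the mean \<open>m\<close> lowers the autocorrelation and the sum of squares
  by the same amount \<open>n * m\<^sup>2\<close>. What remains is
  \<open>(1 - k) * n * m\<^sup>2\<close>, and this is where the threshold \<open>h / n\<close> for
  \<open>\<alpha>\<close> comes from.\<close>

lemma discrete_wirtinger_mean:
  fixes x :: "nat \<Rightarrow> real"
  assumes n: "n > 0"
  defines "k \<equiv> cos (2 * pi / real n)"
  shows "(\<Sum>i<n. x i * x (Suc i mod n))
    \<le> k * (\<Sum>i<n. (x i)\<^sup>2) + (1 - k) / real n * (\<Sum>i<n. x i)\<^sup>2"
proof -
  define m where "m = (\<Sum>i<n. x i) / real n"
  have sum_x: "(\<Sum>i<n. x i) = real n * m"
    using n by (simp add: m_def)
  have sum_x': "(\<Sum>i<n. x (Suc i mod n)) = real n * m"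
    using sum_cyclic_shift[OF n, of x] sum_x by simp
  have "(\<Sum>i<n. (x i - m) * (x (Suc i mod n) - m)) \<le> k * (\<Sum>i<n. (x i - m)\<^sup>2)"
    unfolding k_def
    using discrete_wirtinger[OF n, of "\<lambda>i. x i - m"] by (simp add: sum_subtractf sum_x)
  moreover have "(\<Sum>i<n. (x i - m) * (x (Suc i mod n) - m))
      = (\<Sum>i<n. x i * x (Suc i mod n)) - real n * m\<^sup>2"
    by (simp add: algebra_simps sum.distrib sum_subtractf sum_distrib_left[symmetric]
        sum_x sum_x' power2_eq_square)
  moreover have "(\<Sum>i<n. (x i - m)\<^sup>2) = (\<Sum>i<n. (x i)\<^sup>2) - real n * m\<^sup>2"
    by (simp add: power2_diff sum.distrib sum_subtractf sum_distrib_left[symmetric]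
        sum_distrib_right[symmetric] sum_x power2_eq_square algebra_simps)
  moreover have "(1 - k) / real n * (\<Sum>i<n. x i)\<^sup>2 = (1 - k) * (real n * m\<^sup>2)"
    using n by (simp add: sum_x power2_eq_square)
  ultimately show ?thesis
    by (simp add: algebra_simps)
qed


section \<open>Digraphs with all in- and outdegrees one\<close>

text \<open>Unfolds the recursive walk condition into one on positions, so that a closed walk can be
  read with indices modulo its length and compared between digraphs sharing tails and heads.\<close>

lemma (in pre_digraph) cas_iff_nth:
  assumes "p \<noteq> []"
  shows "cas u p w \<longleftrightarrow> tail G (p ! 0) = u \<and>
    (\<forall>i<length p. head G (p ! i) = (if Suc i < length p then tail G (p ! Suc i) else w))"
  using assms
proof (induction p arbitrary: u)
  case (Cons e p)
  show ?case
  proof (cases "p = []")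
    case False
    then show ?thesis
      using Cons.IH[of "head G e"] by (auto simp: All_less_Suc2)
  qed auto
qed simp

locale one_regular_digraph = digraph +
  assumes degrees: "u \<in> verts G \<Longrightarrow> in_degree G u = 1 \<and> out_degree G u = 1"
begin

lemma bij_tail: "bij_betw (tail G) (arcs G) (verts G)"
proof -
  have ex1: "\<exists>!e. e \<in> arcs G \<and> tail G e = u" if u: "u \<in> verts G" for u
  proof -
    obtain e where "out_arcs G u = {e}"
      using degrees[OF u] by (auto simp: out_degree_def card_1_singleton_iff)
    then show ?thesis
      by (intro ex1I[of _ e]) (auto simp: out_arcs_def)
  qed
  show ?thesis
  proof (rule bij_betw_imageI)
    show "inj_on (tail G) (arcs G)"
      using ex1 tail_in_verts by (intro inj_onI) blast
    show "tail G ` arcs G = verts G"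
      using ex1 by fastforce
  qed
qed

lemma bij_head: "bij_betw (head G) (arcs G) (verts G)"
proof -
  have ex1: "\<exists>!e. e \<in> arcs G \<and> head G e = u" if u: "u \<in> verts G" for u
  proof -
    obtain e where "in_arcs G u = {e}"
      using degrees[OF u] by (auto simp: in_degree_def card_1_singleton_iff)
    then show ?thesis
      by (intro ex1I[of _ e]) (auto simp: in_arcs_def)
  qed
  show ?thesis
  proof (rule bij_betw_imageI)
    show "inj_on (head G) (arcs G)"
      using ex1 head_in_verts by (intro inj_onI) blast
    show "head G ` arcs G = verts G"
      using ex1 by fastforce
  qed
qed

lemma sum_tail: "(\<Sum>e\<in>arcs G. f (tail G e)) = (\<Sum>u\<in>verts G. f u)"
  by (rule sum.reindex_bij_betw[OF bij_tail])

text \<open>Following the unique outgoing arcs permutes the vertices. The orbit of any vertex is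
  closed along arcs in both directions, so \<open>conn\<close> makes it the whole vertex set, and
  its outgoing arcs in orbit order form the cycle. Connectedness is phrased by closed sets because a
  violating set directly yields a test function for the quadratic form.\<close>

lemma hamiltonian_cycle_if_connected:
  assumes ne: "verts G \<noteq> {}"
    and conn: "\<And>S. S \<subseteq> verts G \<Longrightarrow> S \<noteq> {} \<Longrightarrow>
      (\<And>e. e \<in> arcs G \<Longrightarrow> tail G e \<in> S \<longleftrightarrow> head G e \<in> S) \<Longrightarrow> S = verts G"
  shows "\<exists>p. hamiltonian_cycle G p \<and> set p = arcs G"
proof -
  \<comment> \<open>\<open>a u\<close> is the only arc leaving \<open>u\<close>, and
    \<open>s u\<close> its head. Outside the vertices \<open>s\<close> is the identity, as
    \<open>permutes\<close> demands.\<close>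
  define a where "a = the_inv_into (arcs G) (tail G)"
  define s where "s u = (if u \<in> verts G then head G (a u) else u)" for u
  have bij_a: "bij_betw a (verts G) (arcs G)"
    unfolding a_def by (rule bij_betw_the_inv_into[OF bij_tail])
  have a_arc: "a u \<in> arcs G" and tail_a: "tail G (a u) = u" if "u \<in> verts G" for u
    using bij_a that bij_tail
    by (auto simp: a_def bij_betw_def intro: f_the_inv_into_f)
  have s_tail: "s (tail G e) = head G e" if "e \<in> arcs G" for e
    using that bij_tail by (simp add: s_def a_def bij_betw_def the_inv_into_f_f)
  have "bij_betw (head G \<circ> a) (verts G) (verts G)"
    using bij_a bij_head by (rule bij_betw_trans)
  then have "bij_betw s (verts G) (verts G)"
    by (rule bij_betw_cong[THEN iffD1, rotated]) (simp add: s_def)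
  then have perm: "s permutes verts G"
    by (rule bij_imp_permutes) (simp add: s_def)
  then have permutation: "permutation s"
    using permutation_permutes finite_verts by blast
  obtain u where u: "u \<in> verts G"
    using ne by auto
  \<comment> \<open>\<open>us\<close> is the orbit \<open>u\<close>, \<open>s u\<close>, and so on,
    up to the last element before the return to \<open>u\<close> after \<open>m\<close>
    steps.\<close>
  define m where "m = least_power s u"
  define us where "us = support s u"
  have m: "m > 0" "(s ^^ m) u = u"
    using least_power_of_permutation[OF permutation, of u] by (auto simp: m_def)
  have dist: "distinct us"
    unfolding us_def by (rule cycle_of_permutation[OF permutation])
  have len: "length us = m"
    by (simp add: us_def m_def)
  have nth: "us ! i = (s ^^ i) u" if "i < m" for i
    using that by (simp add: us_def m_def)
  have s_us: "s (us ! i) = us ! (if Suc i < m then Suc i else 0)" if "i < m" for i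
  proof (cases "Suc i < m")
    case False
    then have "Suc i = m"
      using that by simp
    have "s (us ! i) = (s ^^ Suc i) u"
      by (simp add: nth[OF that])
    also have "\<dots> = us ! 0"
      unfolding \<open>Suc i = m\<close> by (simp add: m nth)
    finally show ?thesis
      using False by simp
  qed (use that nth in simp)
  have us_verts: "set us \<subseteq> verts G"
  proof -
    have "(s ^^ i) u \<in> verts G" for i
      by (induction i) (auto simp: u permutes_in_image[OF perm])
    then show ?thesis
      by (auto simp: us_def)
  qed
  have "s ` set us \<subseteq> set us"
  proof safe
    fix w assume "w \<in> set us"
    then obtain i where i: "i < m" "w = us ! i"
      by (metis in_set_conv_nth len)
    then show "s w \<in> set us"
      using s_us[OF i(1)] m len by auto
  qed
  \<comment> \<open>An injection of a finite set into itself is onto. Equality is needed to go back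
    along an arc, from its head in the orbit to its tail.\<close>
  then have s_image: "s ` set us = set us"
    by (intro card_subset_eq) (simp_all add: card_image permutes_inj_on[OF perm])
  have us: "set us = verts G"
  proof (rule conn[OF us_verts])
    show "set us \<noteq> {}"
      using len m by auto
    fix e assume "e \<in> arcs G"
    then have "head G e = s (tail G e)"
      using s_tail by simp
    then show "tail G e \<in> set us \<longleftrightarrow> head G e \<in> set us"
      using s_image permutes_inj[OF perm] by (metis inj_image_mem_iff)
  qed
  define p where "p = map a us"
  have p_ne: "p \<noteq> []" and len_p: "length p = m"
    using len m by (auto simp: p_def)
  have tails: "map (tail G) p = us"
    unfolding p_def map_map by (rule map_idI) (simp add: tail_a us)
  have set_p: "set p = arcs G"
    using bij_a us by (simp add: p_def bij_betw_def)
  have head_p: "head G (p ! i) = us ! (if Suc i < m then Suc i else 0)" if "i < m" for i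
  proof -
    have "us ! i \<in> verts G"
      using us that len nth_mem by blast
    then show ?thesis
      using s_us[OF that] that len by (simp add: p_def s_def)
  qed
  have tail_p: "tail G (p ! i) = us ! i" if "i < m" for i
    using that tails len_p nth_map by metis
  have cas: "cas u p u"
    using p_ne m nth[of 0] by (auto simp: cas_iff_nth len_p tail_p head_p)
  have "distinct p"
    using tails dist distinct_map by metis
  \<comment> \<open>The definition of \<open>cycle\<close> wants the visited vertices distinct after
    dropping the first; these are the heads of the arcs.\<close>
  then have "distinct (map (head G) p)"
    using bij_head set_p by (simp add: distinct_map bij_betw_def)
  then have "cycle p"
    using cas u set_p p_ne
    by (auto simp: cycle_def awalk_def awalk_verts_conv')
  moreover have "tail G ` set p = verts G"
    using tails us by (metis set_map)
  ultimately show ?thesis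
    using set_p by (auto simp: hamiltonian_cycle_def)
qed

text \<open>Take \<open>y\<close> to be \<open>f\<close> along the tails of the arcs of
  \<open>p\<close>; the head of each arc is the tail of its cyclic successor. With \<open>g\<close>
  arbitrary, one \<open>y\<close> serves both the sum and the sum of squares.\<close>

lemma hamiltonian_cycle_sum:
  fixes f :: "'a \<Rightarrow> real"
  assumes "cycle p" "set p = arcs G"
  defines "n \<equiv> card (verts G)"
  shows "\<exists>y. (\<forall>g. (\<Sum>u\<in>verts G. g (f u)) = (\<Sum>i<n. g (y i) :: real)) \<and>
    (\<Sum>e\<in>arcs G. f (tail G e) * f (head G e)) = (\<Sum>i<n. y i * y (Suc i mod n))"
proof -
  obtain u where cas: "cas u p u" and dist: "distinct p" and ne: "p \<noteq> []"
    using assms(1) by (auto simp: cycle_conv awalk_def)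
  have n: "length p = n"
    using dist assms(2) bij_betw_same_card[OF bij_tail] by (metis n_def distinct_card)
  have sum_arcs: "(\<Sum>e\<in>arcs G. g e) = (\<Sum>i<n. g (p ! i))" for g :: "'b \<Rightarrow> real"
    using sum.reindex_bij_betw[OF bij_betw_nth[OF dist refl refl], of g] assms(2) n by simp
  \<comment> \<open>At the last position the walk closes up at \<open>u\<close>, the tail of arc 0,
    which matches the index wrapping to 0.\<close>
  have head: "head G (p ! i) = tail G (p ! (Suc i mod n))" if "i < n" for i
    using cas ne that by (cases "Suc i = n") (auto simp: cas_iff_nth n)
  show ?thesis
    by (rule exI[of _ "\<lambda>i. f (tail G (p ! i))"])
      (simp add: sum_tail[symmetric] sum_arcs head)
qed

end

section \<open>The quadratic form of the matrix as a sum over arcs\<close>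

text \<open>The entries select the ordered pairs of vertices joined by an arc; without parallel
  arcs, these pairs correspond one to one to the arcs.\<close>

lemma adjacency_quadratic_form:
  fixes f :: "'a \<Rightarrow> real"
  assumes H: "digraph H" and v: "bij_betw v {0..<n} (verts H)"
  shows "(\<Sum>i<n. \<Sum>j<n. adjacency_matrix H v n $$ (i, j) * f (v i) * f (v j))
    = (\<Sum>e\<in>arcs H. f (tail H e) * f (head H e))"
proof -
  interpret digraph H by fact
  define g where "g = (\<lambda>(a, b). f a * f b)"
  have v': "bij_betw v {..<n} (verts H)"
    using v by (simp add: lessThan_atLeast0)
  have "(\<Sum>i<n. \<Sum>j<n. adjacency_matrix H v n $$ (i, j) * f (v i) * f (v j))
    = (\<Sum>i<n. \<Sum>j<n. if v i \<rightarrow>\<^bsub>H\<^esub> v j then g (v i, v j) else 0)"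
    by (intro sum.cong refl) (auto simp: adjacency_matrix_def g_def)
  also have "\<dots> = (\<Sum>a\<in>verts H. \<Sum>b\<in>verts H. if a \<rightarrow>\<^bsub>H\<^esub> b then g (a, b) else 0)"
    by (simp add: sum.reindex_bij_betw[OF v', symmetric])
  also have "\<dots> = (\<Sum>x\<in>verts H \<times> verts H. if x \<in> arcs_ends H then g x else 0)"
    unfolding sum.cartesian_product by (intro sum.cong refl) auto
  also have "\<dots> = (\<Sum>x\<in>arcs_ends H. g x)"
    by (intro sum.mono_neutral_cong_right) (auto simp: arcs_ends_conv)
  also have "\<dots> = (\<Sum>e\<in>arcs H. g (arc_to_ends H e))"
    unfolding arcs_ends_def
    by (rule sum.reindex[unfolded comp_def]) (auto simp: inj_on_def intro: no_multi_arcs)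
  finally show ?thesis
    by (simp add: g_def arc_to_ends_def)
qed

lemma scalar_prod_mult_mat_vec:
  fixes A :: "'c::comm_semiring_0 mat"
  assumes "A \<in> carrier_mat n n" "x \<in> carrier_vec n"
  shows "x \<bullet> (A *\<^sub>v x) = (\<Sum>i<n. \<Sum>j<n. A $$ (i, j) * x $ i * x $ j)"
  using assms
  by (auto simp: scalar_prod_def lessThan_atLeast0 sum_distrib_left ac_simps intro!: sum.cong)

text \<open>Vectors correspond to functions on the vertices through the numbering \<open>v\<close>.
  The matrix and its transpose have the same quadratic form, so the factor 1/2 leaves one arc
  sum.\<close>

lemma pos_semidef_iff:
  fixes \<alpha> \<beta> :: real
  assumes H: "digraph H" and v: "bij_betw v {0..<n} (verts H)"
    and X: "X = adjacency_matrix H v n"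
  shows "pos_semidef (\<beta> \<cdot>\<^sub>m 1\<^sub>m n + \<alpha> \<cdot>\<^sub>m all_ones_mat n - (1 / 2) \<cdot>\<^sub>m (X + transpose_mat X))
    \<longleftrightarrow> (\<forall>f. (\<Sum>e\<in>arcs H. f (tail H e) * f (head H e))
        \<le> \<beta> * (\<Sum>u\<in>verts H. (f u)\<^sup>2) + \<alpha> * (\<Sum>u\<in>verts H. f u)\<^sup>2)"
    (is "pos_semidef ?M \<longleftrightarrow> (\<forall>f. ?E f \<le> ?R f)")
proof -
  have X_carrier: "X \<in> carrier_mat n n"
    by (simp add: X adjacency_matrix_def)
  have M: "?M \<in> carrier_mat n n"
    by (intro minus_carrier_mat smult_carrier_mat add_carrier_mat X_carrier
        transpose_carrier_mat[THEN iffD2])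
  have sym: "transpose_mat ?M = ?M"
    using X_carrier by (intro eq_matI) (auto simp: all_ones_mat_def add.commute)
  have v': "bij_betw v {..<n} (verts H)"
    using v by (simp add: lessThan_atLeast0)
  have form: "x \<bullet> (?M *\<^sub>v x) = ?R f - ?E f"
    if x: "x \<in> carrier_vec n" and xf: "\<And>i. i < n \<Longrightarrow> x $ i = f (v i)" for x f
  proof -
    have E: "(\<Sum>i<n. \<Sum>j<n. X $$ (i, j) * f (v i) * f (v j)) = ?E f"
      unfolding X by (rule adjacency_quadratic_form[OF H v])
    then have E': "(\<Sum>i<n. \<Sum>j<n. X $$ (j, i) * f (v i) * f (v j)) = ?E f"
      by (subst sum.swap) (simp add: mult_ac)
    have "x \<bullet> (?M *\<^sub>v x) = (\<Sum>i<n. \<Sum>j<n. ?M $$ (i, j) * f (v i) * f (v j))"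
      unfolding scalar_prod_mult_mat_vec[OF M x] by (intro sum.cong refl) (simp add: xf)
    also have "\<dots> = (\<Sum>i<n. \<Sum>j<n. (if j = i then \<beta> * (f (v i))\<^sup>2 else 0)
        + \<alpha> * (f (v i) * f (v j))
        - (X $$ (i, j) * f (v i) * f (v j) + X $$ (j, i) * f (v i) * f (v j)) / 2)"
      using X_carrier
      by (intro sum.cong refl)
        (auto simp: all_ones_mat_def one_mat_def algebra_simps power2_eq_square add_divide_distrib)
    also have "\<dots> = \<beta> * (\<Sum>i<n. (f (v i))\<^sup>2) + \<alpha> * (\<Sum>i<n. f (v i))\<^sup>2 - ?E f"
      by (simp add: sum_subtractf sum.distrib sum_divide_distrib[symmetric] E E'
          sum_distrib_left[symmetric] sum_product power2_eq_square)
    finally show ?thesis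
      by (simp add: sum.reindex_bij_betw[OF v', symmetric])
  qed
  show ?thesis
  proof
    assume psd: "pos_semidef ?M"
    show "\<forall>f. ?E f \<le> ?R f"
    proof
      fix f
      have "0 \<le> vec n (\<lambda>i. f (v i)) \<bullet> (?M *\<^sub>v vec n (\<lambda>i. f (v i)))"
        using psd M by (auto simp: pos_semidef_def)
      then show "?E f \<le> ?R f"
        by (subst (asm) form[where f = f]) auto
    qed
  next
    assume le: "\<forall>f. ?E f \<le> ?R f"
    have "0 \<le> x \<bullet> (?M *\<^sub>v x)" if x: "x \<in> carrier_vec n" for x
    proof -
      define f where "f u = x $ the_inv_into {0..<n} v u" for u
      have "x $ i = f (v i)" if "i < n" for i
        using that v by (simp add: f_def the_inv_into_f_f bij_betw_def)
      then show ?thesis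
        using form[OF x, of f] le by simp
    qed
    then show "pos_semidef ?M"
      using carrier_matD[OF X_carrier] sym by (simp add: pos_semidef_def)
  qed
qed

section \<open>From the Wirtinger inequality to semidefiniteness, and from semidefiniteness to
  connectedness\<close>

theorem theorem10:
  fixes G H :: "('a, 'b) pre_digraph"
    and n :: nat
    and v :: "nat \<Rightarrow> 'a"
    and X :: "real mat"
    and k h \<alpha> \<beta> :: real
  assumes "digraph G"
    and "bij_betw v {0..<n} (verts G)"
    and "spanning H G"
    and "\<forall>u \<in> verts H. in_degree H u = 1 \<and> out_degree H u = 1"
    and "X = adjacency_matrix H v n"
    and "k = cos (2 * pi / real n)"
    and "h = 1 - k"
    and "\<alpha> \<ge> h / real n"
    and "k \<le> \<beta>" and "\<beta> < 1"
  shows "is_hamiltonian_cycle_of H G \<longleftrightarrow>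
    pos_semidef (\<beta> \<cdot>\<^sub>m 1\<^sub>m n + \<alpha> \<cdot>\<^sub>m all_ones_mat n
                 - (1 / 2) \<cdot>\<^sub>m (X + transpose_mat X))"
proof -
  interpret G: digraph G by fact
  have sub: "subgraph H G" and verts: "verts H = verts G"
    using assms(3) by (auto simp: spanning_def)
  interpret H: digraph H
    by (rule G.digraph_subgraph[OF sub])
  interpret H: one_regular_digraph H
    by unfold_locales (use assms(4) in blast)
  have ends: "tail G = tail H" "head G = head H"
    using sub by (auto simp: subgraph_def compatible_def)
  have card: "card (verts H) = n"
    using bij_betw_same_card[OF assms(2)] by (simp add: verts)
  \<comment> \<open>For \<open>n = 0\<close> division by zero gives \<open>k = cos 0 = 1\<close>,
    contradicting \<open>k \<le> \<beta> < 1\<close>.\<close>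
  have n: "n > 0"
    using assms(6,9,10) by (cases n) auto
  have v: "bij_betw v {0..<n} (verts H)"
    using assms(2) verts by simp
  note psd = pos_semidef_iff[OF H.digraph_axioms v assms(5)]
  show ?thesis
    unfolding psd
  proof
    assume "is_hamiltonian_cycle_of H G"
    then obtain p where p: "G.cycle p" "set p = arcs H"
      by (auto simp: is_hamiltonian_cycle_of_def hamiltonian_cycle_def)
    \<comment> \<open>All arcs of \<open>p\<close> lie in \<open>H\<close>, and both digraphs share
      vertices, tails and heads, so the cycle conditions carry over.\<close>
    have cycle: "H.cycle p"
    proof -
      obtain u where u: "G.awalk u p u" "distinct (tl (G.awalk_verts u p))" "p \<noteq> []"
        using p(1) by (auto simp: G.cycle_def)
      then have "H.awalk u p u" "distinct (tl (H.awalk_verts u p))"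
        using p(2) sub verts
        by (auto simp: G.awalk_def H.awalk_def G.awalk_verts_conv H.awalk_verts_conv ends
            G.cas_iff_nth H.cas_iff_nth)
      then show ?thesis
        using u(3) by (auto simp: H.cycle_def)
    qed
    show "\<forall>f. (\<Sum>e\<in>arcs H. f (tail H e) * f (head H e))
        \<le> \<beta> * (\<Sum>u\<in>verts H. (f u)\<^sup>2) + \<alpha> * (\<Sum>u\<in>verts H. f u)\<^sup>2"
    proof
      fix f :: "'a \<Rightarrow> real"
      obtain y where y: "\<And>g. (\<Sum>u\<in>verts H. g (f u)) = (\<Sum>i<n. g (y i) :: real)"
        and E: "(\<Sum>e\<in>arcs H. f (tail H e) * f (head H e)) = (\<Sum>i<n. y i * y (Suc i mod n))"
        using H.hamiltonian_cycle_sum[OF cycle p(2), of f] unfolding card by blast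
      have "(\<Sum>e\<in>arcs H. f (tail H e) * f (head H e))
          \<le> k * (\<Sum>i<n. (y i)\<^sup>2) + h / real n * (\<Sum>i<n. y i)\<^sup>2"
        unfolding E assms(6,7) by (rule discrete_wirtinger_mean[OF n])
      also have "\<dots> \<le> \<beta> * (\<Sum>i<n. (y i)\<^sup>2) + \<alpha> * (\<Sum>i<n. y i)\<^sup>2"
        using assms(8,9) by (intro add_mono mult_right_mono) (auto intro: sum_nonneg)
      finally show "(\<Sum>e\<in>arcs H. f (tail H e) * f (head H e))
        \<le> \<beta> * (\<Sum>u\<in>verts H. (f u)\<^sup>2) + \<alpha> * (\<Sum>u\<in>verts H. f u)\<^sup>2"
        using y[of "\<lambda>t. t"] y[of "\<lambda>t. t\<^sup>2"] by simp
    qed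
  next
    assume le: "\<forall>f. (\<Sum>e\<in>arcs H. f (tail H e) * f (head H e))
        \<le> \<beta> * (\<Sum>u\<in>verts H. (f u)\<^sup>2) + \<alpha> * (\<Sum>u\<in>verts H. f u)\<^sup>2"
    have "\<exists>p. hamiltonian_cycle H p \<and> set p = arcs H"
    proof (rule H.hamiltonian_cycle_if_connected)
      show "verts H \<noteq> {}"
        using card n by auto
      fix S assume S: "S \<subseteq> verts H" "S \<noteq> {}"
        and closed: "\<And>e. e \<in> arcs H \<Longrightarrow> tail H e \<in> S \<longleftrightarrow> head H e \<in> S"
      show "S = verts H"
      proof (rule ccontr)
        assume "S \<noteq> verts H"
        define T where "T = verts H - S"
        have fin: "finite S" "finite T"
          using finite_subset[OF S(1) H.finite_verts] by (auto simp: T_def)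
        have pos: "card S > 0" "card T > 0"
          using fin S \<open>S \<noteq> verts H\<close> by (auto simp: T_def card_gt_0_iff)
        \<comment> \<open>Each side is weighted by the size of the other, with opposite signs, so
          that the values sum to zero and the \<open>\<alpha>\<close> term disappears for every
          \<open>\<alpha>\<close>.\<close>
        define f where "f u = (if u \<in> S then real (card T) else - real (card S))" for u
        have verts_split: "verts H = S \<union> T" "S \<inter> T = {}"
          using S by (auto simp: T_def)
        have sum0: "(\<Sum>u\<in>verts H. f u) = 0"
        proof -
          have "(\<Sum>u\<in>T. f u) = (\<Sum>u\<in>T. - real (card S))"
            by (intro sum.cong) (auto simp: f_def T_def)
          then show ?thesis
            using fin verts_split by (simp add: sum.union_disjoint f_def)
        qed
        \<comment> \<open>No arc joins \<open>S\<close> to its complement, so \<open>f\<close> is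
          constant along arcs. The arc sum then becomes the full sum of squares, which is positive
          and cannot be bounded by \<open>\<beta> < 1\<close> times itself.\<close>
        have "f (tail H e) = f (head H e)" if "e \<in> arcs H" for e
          using closed[OF that] by (simp add: f_def)
        then have "(\<Sum>e\<in>arcs H. f (tail H e) * f (head H e)) = (\<Sum>e\<in>arcs H. (f (tail H e))\<^sup>2)"
          by (simp add: power2_eq_square)
        also have "\<dots> = (\<Sum>u\<in>verts H. (f u)\<^sup>2)"
          by (rule H.sum_tail)
        finally have "(\<Sum>u\<in>verts H. (f u)\<^sup>2) \<le> \<beta> * (\<Sum>u\<in>verts H. (f u)\<^sup>2)"
          using le[rule_format, of f] sum0 by simp
        moreover have "(\<Sum>u\<in>verts H. (f u)\<^sup>2) > 0"
          using pos \<open>verts H \<noteq> {}\<close> by (intro sum_pos) (auto simp: f_def)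
        ultimately show False
          using assms(10) by simp
      qed
    qed
    then obtain p where p: "H.cycle p" "tail H ` set p = verts H" "set p = arcs H"
      by (auto simp: hamiltonian_cycle_def)
    then have "hamiltonian_cycle G p"
      using G.subgraph_cycle[OF sub] by (simp add: hamiltonian_cycle_def ends verts)
    then show "is_hamiltonian_cycle_of H G"
      using p(3) assms(3) by (auto simp: is_hamiltonian_cycle_of_def)
  qed
qed

end
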